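(* Let $0<\phi<\pi$. Then $\{P_n^{(0)}(x;\phi)\mid n\ge 0\}$ is an orthonormal set with respect to the inner product $$\langle f,g\rangle=f(0)g(0)+\frac{1}{4\pi\sin(\phi)}\int_{-\infty}^{\infty}\boldsymbol{\delta} f(x)\,\boldsymbol{\delta} g(x)\,e^{(2\phi-\pi)x}\left|\Gamma\left(\tfrac12+\mathrm{i}x\right)\right|^2dx,$$ where $$\boldsymbol{\delta} f(x)=f\left(x+\tfrac12\right)-f\left(x-\tfrac12\right).$$ That is, $\langle P_n^{(0)},P_m^{(0)}\rangle=\delta_{n,m}$ (Kronecker delta) for all $n,m\ge 0$.
   Context: The Meixner–Pollaczek polynomials for $\lambda>0$, $0<\phi<\pi$ are $$P_n^{(\lambda)}(x;\phi)=\frac{(2\lambda)_n}{n!}e^{\mathrm{i}n\phi}\,{}_2F_1\left(-n,\lambda+\mathrm{i}x;2\lambda;1-e^{-2\mathrm{i}\phi}\right).$$ For $\lambda=0$ they are defined by $P_0^{(0)}(x;\phi)=1$ and $P_n^{(0)}(x;\phi)=\frac{2x}{n}\sin(\phi)\,P_{n-1}^{(1)}(x;\phi)$ for $n\ge1$.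
   Formalization: The difference operator is taken as δf(x) = (f(x+i/2) − f(x−i/2))/i instead of f(x+1/2) − f(x−1/2); with the printed real shifts orthonormality fails, e.g. ⟨P_1,P_3⟩ = 1/3 at φ = π/2. *)

theory Defs
  imports "HOL-Analysis.Analysis"
begin

(* In the library, "F as bs c" is the hypergeometric series in c * X as a formal power series.
   For parameters with a = -n the series is a finite sum, so the radius of convergence plays no
   role when evaluating it. *)

definition hyp2F1 :: "complex \<Rightarrow> complex \<Rightarrow> complex \<Rightarrow> complex \<Rightarrow> complex" where
  "hyp2F1 a b c z = eval_fps (fps_hypergeo [a, b] [c] 1) z"

(* The variable x is complex because the difference operator below shifts it off the real line. *)

definition meixner_pollaczek :: "real \<Rightarrow> real \<Rightarrow> nat \<Rightarrow> complex \<Rightarrow> complex" where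
  "meixner_pollaczek lam phi n x =
     pochhammer (2 * complex_of_real lam) n / fact n * exp (\<i> * of_nat n * complex_of_real phi) *
     hyp2F1 (- of_nat n) (complex_of_real lam + \<i> * x) (2 * complex_of_real lam)
            (1 - exp (- 2 * \<i> * complex_of_real phi))"

definition meixner_pollaczek_0 :: "real \<Rightarrow> nat \<Rightarrow> complex \<Rightarrow> complex" where
  "meixner_pollaczek_0 phi n x =
     (if n = 0 then 1
      else 2 * x / of_nat n * complex_of_real (sin phi) * meixner_pollaczek 1 phi (n - 1) x)"

(* The central difference of Meixner-Pollaczek theory has step i:
     delta f(x) = (f(x + i/2) - f(x - i/2)) / i,
   so that delta P_n^(0) = 2 sin(phi) P_(n-1)^(1/2), and delta f is real on the real line
   whenever f is a polynomial with real coefficients.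
   It is sometimes printed with the real shifts x + 1/2, x - 1/2. Read like that, orthonormality
   fails: for phi = pi/2 and w(x) = |Gamma(1/2 + i x)|^2 the polynomials are P_1 = 2 x,
   P_2 = 2 x^2, P_3 = (4 x^3 - 2 x) / 3, with real differences 2, 4 x, 4 x^2 - 1/3, so that
   <P_1,P_1> = <P_2,P_2> = 1 and <P_1,P_3> = 0 would force the integral of x^2 w(x) to be
   both pi/4 and pi/12. With shifts by i/2 but without the division by i, the product of two
   differences changes sign and <P_n,P_n> = -1 for n >= 1. *)

definition central_diff :: "(complex \<Rightarrow> complex) \<Rightarrow> complex \<Rightarrow> complex" where
  "central_diff f x = (f (x + \<i> / 2) - f (x - \<i> / 2)) / \<i>"

definition mp0_integrand ::
    "real \<Rightarrow> (complex \<Rightarrow> complex) \<Rightarrow> (complex \<Rightarrow> complex) \<Rightarrow> real \<Rightarrow> complex" where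
  "mp0_integrand phi f g x =
     central_diff f (complex_of_real x) * central_diff g (complex_of_real x) *
     complex_of_real (exp ((2 * phi - pi) * x) *
                      (norm (Gamma (1 / 2 + \<i> * complex_of_real x)))\<^sup>2)"

definition mp0_inner ::
    "real \<Rightarrow> (complex \<Rightarrow> complex) \<Rightarrow> (complex \<Rightarrow> complex) \<Rightarrow> complex" where
  "mp0_inner phi f g =
     f 0 * g 0 +
     complex_of_real (1 / (4 * pi * sin phi)) * (LINT x|lborel. mp0_integrand phi f g x)"

end

theory Submission
  imports Defs "HOL-Real_Asymp.Real_Asymp"
begin

text \<open>The difference operator sends P_(n+1)^(0) to 2 sin(phi) P_n^(1/2), so it suffices to treat the
  polynomials P_n^(1/2), whose weight is elementary: by Gamma reflection it is
  w(x) = e^((2 phi - pi) x) pi / cosh(pi x). The logit substitution turns the integral of w into a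
  Beta integral, with value pi / sin(phi). Differentiating with respect to phi multiplies the
  integrand by 2 x, which yields by induction the integrals of the rising factorials
  (1/2 + i x)_k against w. These show that P_n^(1/2) integrates to 0 for n > 0 (a binomial sum of
  1 - 1). As multiplication by x is symmetric, the three-term recurrence then gives orthogonality,
  as in Favard's theorem.\<close>

section \<open>The elementary weight, its total mass and the Gamma modulus\<close>

definition mp_weight :: "real \<Rightarrow> real \<Rightarrow> real" where
  "mp_weight phi x = exp ((2 * phi - pi) * x) * (pi / cosh (pi * x))"

lemma mp_weight_nonneg: "mp_weight phi x \<ge> 0"
  by (simp add: mp_weight_def)

text \<open>Moving \<open>phi\<close> amounts to an exponential factor in \<open>x\<close>. Both the
  domination estimates and the derivative in \<open>phi\<close> rest on this.\<close>

lemma mp_weight_shift: "mp_weight (phi + h) x = exp (2 * h * x) * mp_weight phi x"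
  by (simp add: mp_weight_def algebra_simps flip: exp_add)

lemma mp_weight_measurable [measurable]: "mp_weight phi \<in> borel_measurable borel"
  unfolding mp_weight_def cosh_def by measurable

text \<open>The second factor on the left is the derivative of the logit map, so this is the
  pulled-back integrand: a Beta density with parameters phi/pi and 1 - phi/pi.\<close>

lemma mp_weight_logit:
  assumes "0 < t" "t < 1"
  shows "mp_weight phi ((ln t - ln (1 - t)) / (2 * pi)) * (1 / (2 * pi * (t * (1 - t)))) =
         t powr (phi / pi - 1) * (1 - t) powr (- (phi / pi))"
proof -
  define x where "x = (ln t - ln (1 - t)) / (2 * pi)"
  have e1: "exp (2 * pi * x) = t / (1 - t)"
    using assms by (simp add: x_def exp_diff)
  have e2: "exp (2 * phi * x) = t powr (phi / pi) * (1 - t) powr (- (phi / pi))"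
    using assms by (simp add: x_def powr_def field_simps flip: exp_add)
  \<comment> \<open>In terms of \<open>u\<close> and exp(2 phi x) the weight is rational, which
    gives 2 pi exp(2 phi x) / (exp(2 pi x) + 1); the denominator is 1 / (1 - t).\<close>
  define u where "u = exp (pi * x)"
  have u: "u > 0" "exp (2 * pi * x) = u * u" "exp ((2 * phi - pi) * x) = exp (2 * phi * x) / u"
    "cosh (pi * x) = (u + 1 / u) / 2"
    by (simp_all add: u_def cosh_def exp_minus inverse_eq_divide left_diff_distrib exp_diff
        flip: exp_add)
  have "u * u + 1 \<noteq> 0" using u(1) by (metis add_pos_pos less_irrefl mult_pos_pos zero_less_one)
  hence "mp_weight phi x = 2 * pi * exp (2 * phi * x) / (exp (2 * pi * x) + 1)"
    using u(1) unfolding mp_weight_def u(2-) by (simp add: divide_simps)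
  also have "\<dots> = 2 * pi * (1 - t) * (t powr (phi / pi) * (1 - t) powr (- (phi / pi)))"
  proof -
    have "t / (1 - t) + 1 = 1 / (1 - t)" using assms by (simp add: field_simps)
    thus ?thesis by (simp add: e1 e2)
  qed
  finally show ?thesis
    using assms by (simp add: x_def powr_diff)
qed

text \<open>The parameters add up to 1, so the denominator of the Beta function is Gamma(1) = 1 and
  Euler's reflection formula remains.\<close>

lemma Beta_reflection_real:
  assumes "0 < a" "a < 1"
  shows "Beta a (1 - a) = pi / sin (pi * (a :: real))"
proof -
  have "complex_of_real (Gamma a * Gamma (1 - a)) = of_real (pi / sin (pi * a))"
    using Gamma_reflection_complex[of "of_real a"]
    by (simp flip: Gamma_complex_of_real sin_of_real)
  thus ?thesis
    unfolding Beta_def of_real_eq_iff by simp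
qed

lemma
  assumes "0 < phi" "phi < pi"
  shows mp_weight_integrable: "integrable lborel (mp_weight phi)"
    and mp_weight_integral: "(LINT x|lborel. mp_weight phi x) = pi / sin phi"
proof -
  define g where "g = (\<lambda>t::real. (ln t - ln (1 - t)) / (2 * pi))"
  define g' where "g' = (\<lambda>t::real. 1 / (2 * pi * (t * (1 - t))))"
  define b where "b = (\<lambda>t::real. t powr (phi / pi - 1) * (1 - t) powr (1 - phi / pi - 1))"
  have ein: "einterval 0 1 = {0<..<1::real}"
    by (auto simp: einterval_def zero_ereal_def one_ereal_def)
  have pos: "phi / pi > 0" "1 - phi / pi > 0" using assms by auto
  have fg: "mp_weight phi (g t) * g' t = b t" if "t \<in> {0<..<1}" for t
    using mp_weight_logit[of t phi] that by (simp add: g_def g'_def b_def)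
  have "set_integrable lborel {0..1} b"
    unfolding b_def by (rule integrable_Beta[OF pos])
  hence ib: "set_integrable lborel {0<..<1} b"
    by (rule set_integrable_subset) auto
  hence ifg: "set_integrable lborel {0<..<1} (\<lambda>t. mp_weight phi (g t) * g' t)"
    using fg by (subst set_integrable_cong[OF refl refl, of _ _ b]) auto
  have "(b has_integral Beta (phi / pi) (1 - phi / pi)) {0<..<1}"
    using has_integral_Beta_real[OF pos] unfolding b_def by (simp add: has_integral_Icc_iff_Ioo)
  hence vb: "(LINT t:{0<..<1}|lborel. b t) = pi / sin phi"
    using set_borel_integral_eq_integral(2)[OF ib] Beta_reflection_real[of "phi / pi"] pos
    by (simp add: integral_unique)
  have gi: "(LINT t:{0<..<1}|lborel. mp_weight phi (g t) * g' t) = pi / sin phi"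
    unfolding vb[symmetric] by (rule set_lebesgue_integral_cong) (use fg in auto)
  have lim0: "((ereal \<circ> g \<circ> real_of_ereal) \<longlongrightarrow> -\<infinity>) (at_right 0)"
    unfolding zero_ereal_def ereal_tendsto_simps g_def
    by real_asymp
  have lim1: "((ereal \<circ> g \<circ> real_of_ereal) \<longlongrightarrow> \<infinity>) (at_left 1)"
    unfolding one_ereal_def ereal_tendsto_simps g_def
    by real_asymp
  have inner: "0 < t" "t < 1" if "0 < ereal t" "ereal t < 1" for t
    using that by (auto simp: zero_ereal_def one_ereal_def)
  have der_g: "(g has_real_derivative g' t) (at t)" if "0 < ereal t" "ereal t < 1" for t
    using inner[OF that] unfolding g_def g'_def
    by (auto intro!: derivative_eq_intros simp: field_simps)
  have cont_g': "isCont g' t" if "0 < ereal t" "ereal t < 1" for t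
    using inner[OF that] unfolding g'_def by (intro continuous_intros) auto
  have cont_w: "isCont (mp_weight phi) x" for x
    unfolding mp_weight_def by (intro continuous_intros) (simp add: less_imp_neq[symmetric])
  have g'_nonneg: "0 \<le> g' t" if "0 \<le> ereal t" "ereal t \<le> 1" for t
    using that by (simp add: g'_def zero_ereal_def one_ereal_def)
  \<comment> \<open>For a nonnegative integrand the substitution rule transfers integrability from
    (0,1) to the whole line together with the value.\<close>
  note sub = interval_integral_substitution_nonneg[OF _ der_g cont_w cont_g' mp_weight_nonneg
      g'_nonneg lim0 lim1 ifg[folded ein]]
  have "set_integrable lborel (einterval (-\<infinity>) \<infinity>) (mp_weight phi)"
    "(LBINT x=-\<infinity>..\<infinity>. mp_weight phi x) = (LBINT t=0..1. mp_weight phi (g t) * g' t)"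
    using sub by simp_all
  thus "integrable lborel (mp_weight phi)" "(LINT x|lborel. mp_weight phi x) = pi / sin phi"
    using gi by (auto simp: interval_lebesgue_integral_def ein set_integrable_def set_lebesgue_integral_def)
qed

text \<open>On the line Re z = 1/2 the conjugate of z is 1 - z, so the squared modulus is a
  reflection product; sin(pi (1/2 + i x)) equals cosh(pi x).\<close>

lemma norm_Gamma_half_plus_imaginary:
  "(norm (Gamma (1 / 2 + \<i> * complex_of_real x)))\<^sup>2 = pi / cosh (pi * x)"
proof -
  let ?z = "1 / 2 + \<i> * complex_of_real x"
  have "complex_of_real ((norm (Gamma ?z))\<^sup>2) = Gamma ?z * Gamma (cnj ?z)"
    by (simp only: complex_norm_square cnj_Gamma)
  also have "cnj ?z = 1 - ?z" by (simp add: complex_eq_iff)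
  also have "Gamma ?z * Gamma (1 - ?z) = of_real pi / sin (of_real pi * ?z)"
    by (rule Gamma_reflection_complex)
  also have "sin (of_real pi * ?z) = cos (\<i> * of_real (pi * x))"
    using cos_sin_eq[of "- (\<i> * complex_of_real (pi * x))"] by (simp add: field_simps)
  also have "\<dots> = of_real (cosh (pi * x))"
    by (simp add: cos_exp_eq cosh_def scaleR_conv_of_real flip: exp_of_real mult.assoc)
  finally show ?thesis
    by (metis of_real_divide of_real_eq_iff)
qed

section \<open>Integrability of polynomials against the weight\<close>

text \<open>Exponential growth is absorbed by moving the angle; both directions are included because
  \<open>x\<close> may have either sign.\<close>

lemma exp_abs_mp_weight_le:
  assumes "\<bar>h\<bar> \<le> e"
  shows "exp (2 * \<bar>h * x\<bar>) * mp_weight phi x \<le> mp_weight (phi + e) x + mp_weight (phi - e) x"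
proof -
  have "exp (2 * \<bar>h * x\<bar>) \<le> exp (2 * \<bar>e * x\<bar>)"
    using assms by (simp add: abs_mult mult_right_mono)
  also have "\<dots> \<le> exp (2 * e * x) + exp (2 * (- e) * x)"
    by (cases "e * x \<ge> 0") (simp_all add: mult.assoc)
  finally have "exp (2 * \<bar>h * x\<bar>) * mp_weight phi x \<le>
      (exp (2 * e * x) + exp (2 * (- e) * x)) * mp_weight phi x"
    by (rule mult_right_mono) (rule mp_weight_nonneg)
  thus ?thesis
    using mp_weight_shift[of phi e x] mp_weight_shift[of phi "- e" x] by (simp add: algebra_simps)
qed

lemma margin_exists:
  assumes "0 < phi" "phi < (b :: real)"
  obtains e where "0 < e" "0 < phi - e" "phi - e < b" "0 < phi + e" "phi + e < b"
proof
  let ?e = "min phi (b - phi) / 2"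
  show "0 < ?e" "0 < phi - ?e" "phi - ?e < b" "0 < phi + ?e" "phi + ?e < b"
    using assms by (auto simp: min_def field_simps)
qed

text \<open>Each further factor \<open>x\<close> is bounded by an exponential, which costs a small
  shift of the angle. The induction therefore keeps \<open>phi\<close> arbitrary.\<close>

lemma poly_mp_weight_integrable:
  fixes p :: "complex poly"
  assumes "0 < phi" "phi < pi"
  shows "integrable lborel (\<lambda>x. poly p (of_real x) * of_real (mp_weight phi x))"
  using assms
proof (induction p arbitrary: phi)
  case (pCons a p)
  obtain e where e: "0 < e" "0 < phi - e" "phi - e < pi" "0 < phi + e" "phi + e < pi"
    using margin_exists[OF pCons.prems] by blast
  have "integrable lborel (\<lambda>x. complex_of_real x * poly p (of_real x) * of_real (mp_weight phi x))"
  proof (rule Bochner_Integration.integrable_bound)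
    show "integrable lborel (\<lambda>x. (norm (poly p (of_real x) * of_real (mp_weight (phi + e) x)) +
        norm (poly p (of_real x) * of_real (mp_weight (phi - e) x))) / (2 * e))"
      using pCons.IH[OF e(2,3)] pCons.IH[OF e(4,5)] by auto
    show "(\<lambda>x. complex_of_real x * poly p (of_real x) * of_real (mp_weight phi x))
        \<in> borel_measurable lborel"
      using borel_measurable_integrable[OF pCons.IH[OF pCons.prems]] by (simp add: mult.assoc)
    show "AE x in lborel. norm (complex_of_real x * poly p (of_real x) * of_real (mp_weight phi x))
        \<le> norm ((norm (poly p (of_real x) * complex_of_real (mp_weight (phi + e) x)) +
             norm (poly p (of_real x) * complex_of_real (mp_weight (phi - e) x))) / (2 * e))"
    proof (rule AE_I2)
      fix x :: real
      have "2 * e * \<bar>x\<bar> \<le> exp (2 * \<bar>e * x\<bar>)"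
        using exp_ge_add_one_self[of "2 * \<bar>e * x\<bar>"] e(1) by (simp only: abs_mult abs_of_pos mult.assoc)
      hence "2 * e * \<bar>x\<bar> * mp_weight phi x \<le> exp (2 * \<bar>e * x\<bar>) * mp_weight phi x"
        by (rule mult_right_mono) (rule mp_weight_nonneg)
      also have "\<dots> \<le> mp_weight (phi + e) x + mp_weight (phi - e) x"
        using e(1) by (intro exp_abs_mp_weight_le) simp
      finally have "norm (poly p (of_real x)) * (2 * e * \<bar>x\<bar> * mp_weight phi x) \<le>
             norm (poly p (of_real x)) * (mp_weight (phi + e) x + mp_weight (phi - e) x)"
        by (rule mult_left_mono) simp
      hence "\<bar>x\<bar> * norm (poly p (of_real x)) * mp_weight phi x \<le>
          norm (poly p (of_real x)) * (mp_weight (phi + e) x + mp_weight (phi - e) x) / (2 * e)"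
        using e(1) by (subst pos_le_divide_eq) (simp_all add: mult_ac)
      thus "norm (complex_of_real x * poly p (of_real x) * of_real (mp_weight phi x))
        \<le> norm ((norm (poly p (of_real x) * complex_of_real (mp_weight (phi + e) x)) +
             norm (poly p (of_real x) * complex_of_real (mp_weight (phi - e) x))) / (2 * e))"
        using e(1) by (simp add: norm_mult mp_weight_nonneg distrib_left)
    qed
  qed
  moreover have "integrable lborel (\<lambda>x. a * complex_of_real (mp_weight phi x))"
    using mp_weight_integrable[OF pCons.prems] by (intro integrable_mult_right integrable_of_real)
  ultimately have "integrable lborel (\<lambda>x. a * complex_of_real (mp_weight phi x) +
      complex_of_real x * poly p (of_real x) * of_real (mp_weight phi x))"
    by (intro Bochner_Integration.integrable_add)
  thus ?case by (simp add: algebra_simps)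
qed auto

section \<open>The moment functional and its derivative in the angle\<close>

definition mp_functional :: "real \<Rightarrow> complex poly \<Rightarrow> complex" where
  "mp_functional phi p = (LINT x|lborel. poly p (of_real x) * of_real (mp_weight phi x))"

lemma mp_functional_add:
  assumes "0 < phi" "phi < pi"
  shows "mp_functional phi (p + q) = mp_functional phi p + mp_functional phi q"
  unfolding mp_functional_def
  by (simp add: distrib_right Bochner_Integration.integral_add poly_mp_weight_integrable[OF assms])

lemma mp_functional_smult: "mp_functional phi (smult c p) = c * mp_functional phi p"
  by (simp add: mp_functional_def mult.assoc)

lemma mp_functional_diff:
  assumes "0 < phi" "phi < pi"
  shows "mp_functional phi (p - q) = mp_functional phi p - mp_functional phi q"
  using mp_functional_add[OF assms, of p "smult (-1) q"] mp_functional_smult[of phi "-1" q] by simp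

lemma mp_functional_sum:
  assumes "0 < phi" "phi < pi" "finite A"
  shows "mp_functional phi (\<Sum>k\<in>A. f k) = (\<Sum>k\<in>A. mp_functional phi (f k))"
  using assms(3)
  by induction (simp_all add: mp_functional_add[OF assms(1,2)], simp add: mp_functional_def)

lemma norm_exp_minus_linear_le: "\<bar>exp t - 1 - t\<bar> \<le> exp \<bar>t\<bar> * t\<^sup>2" for t :: real
  using Taylor_exp_field[of t 1] by (simp add: algebra_simps numeral_2_eq_2)

text \<open>Differentiation under the integral sign: the weight depends on \<open>phi\<close>
  through exp(2 phi x), hence the factor 2 x. An error bound quadratic in the increment replaces a
  limit theorem.\<close>

lemma mp_functional_has_vector_derivative:
  assumes "0 < phi" "phi < pi"
  shows "((\<lambda>t. mp_functional t p) has_vector_derivative mp_functional phi ([:0, 2:] * p)) (at phi)"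
proof -
  obtain e where e: "0 < e" "0 < phi - e" "phi - e < pi" "0 < phi + e" "phi + e < pi"
    using margin_exists[OF assms] by blast
  \<comment> \<open>The factor 4 x^2 is the square (2 h x)^2 of the Taylor remainder without h^2;
    the shifted weights absorb its exponential.\<close>
  define B where "B x = norm (poly ([:0, 0, 4:] * p) (of_real x) * of_real (mp_weight (phi + e) x))
    + norm (poly ([:0, 0, 4:] * p) (of_real x) * of_real (mp_weight (phi - e) x))" for x
  have iB: "integrable lborel B"
    unfolding B_def
    by (intro Bochner_Integration.integrable_add integrable_norm poly_mp_weight_integrable e)
  have quad: "norm (mp_functional y p - mp_functional phi p -
      (y - phi) *\<^sub>R mp_functional phi ([:0, 2:] * p)) \<le> (y - phi)\<^sup>2 * integral\<^sup>L lborel B"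
    if y: "\<bar>y - phi\<bar> < e" for y
  proof -
    define h where "h = y - phi"
    define D where "D x = poly p (of_real x) * of_real (mp_weight y x) -
      poly p (of_real x) * of_real (mp_weight phi x) -
      h *\<^sub>R (poly ([:0, 2:] * p) (of_real x) * complex_of_real (mp_weight phi x))" for x
    have y': "0 < y" "y < pi" using y e by auto
    note ints = poly_mp_weight_integrable[OF y'] poly_mp_weight_integrable[OF assms]
    have iD: "integrable lborel D"
      unfolding D_def by (intro Bochner_Integration.integrable_diff integrable_scaleR_right ints)
    have "mp_functional y p - mp_functional phi p - h *\<^sub>R mp_functional phi ([:0, 2:] * p) =
        integral\<^sup>L lborel D"
      unfolding D_def mp_functional_def
      by (simp only: Bochner_Integration.integral_diff Bochner_Integration.integral_scaleR_right
          Bochner_Integration.integrable_diff integrable_scaleR_right ints)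
    also have "norm \<dots> \<le> (LINT x|lborel. h\<^sup>2 * B x)"
    proof (rule Bochner_Integration.integral_norm_bound_integral[OF iD])
      show "integrable lborel (\<lambda>x. h\<^sup>2 * B x)" using iB by simp
      fix x :: real
      let ?w = "mp_weight phi x"
      have "mp_weight y x = exp (2 * h * x) * ?w"
        using mp_weight_shift[of phi h x] by (simp add: h_def)
      hence "D x = poly p (of_real x) * of_real (?w * (exp (2 * h * x) - 1 - 2 * h * x))"
        by (simp add: D_def scaleR_conv_of_real algebra_simps)
      hence "norm (D x) = norm (poly p (of_real x)) * (?w * \<bar>exp (2 * h * x) - 1 - 2 * h * x\<bar>)"
        by (simp only: norm_mult norm_of_real abs_mult abs_of_nonneg[OF mp_weight_nonneg])
      also have "\<dots> \<le> norm (poly p (of_real x)) * (?w * (exp \<bar>2 * h * x\<bar> * (2 * h * x)\<^sup>2))"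
        by (intro mult_left_mono norm_exp_minus_linear_le mp_weight_nonneg norm_ge_zero)
      also have "\<dots> = norm (poly p (of_real x)) * (2 * h * x)\<^sup>2 * (exp (2 * \<bar>h * x\<bar>) * ?w)"
        by (simp add: abs_mult mult_ac)
      also have "\<dots> \<le> norm (poly p (of_real x)) * (2 * h * x)\<^sup>2 *
          (mp_weight (phi + e) x + mp_weight (phi - e) x)"
        using y by (intro mult_left_mono exp_abs_mp_weight_le) (auto simp: h_def)
      also have "\<dots> = h\<^sup>2 * B x"
        by (simp add: B_def norm_mult mp_weight_nonneg power2_eq_square algebra_simps)
      finally show "norm (D x) \<le> h\<^sup>2 * B x" .
    qed
    finally show ?thesis by (simp add: h_def)
  qed
  show ?thesis
    unfolding has_vector_derivative_def
  proof (rule has_derivativeI_sandwich[OF e(1)])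
    show "bounded_linear (\<lambda>x. x *\<^sub>R mp_functional phi ([:0, 2:] * p))"
      by (rule bounded_linear_scaleR_left)
    fix y assume "y \<noteq> phi" "dist y phi < e"
    thus "norm (mp_functional y p - mp_functional phi p -
        (y - phi) *\<^sub>R mp_functional phi ([:0, 2:] * p)) / norm (y - phi) \<le>
        \<bar>y - phi\<bar> * integral\<^sup>L lborel B"
      using quad[of y] by (simp add: dist_real_def divide_le_eq power2_eq_square mult_ac)
  next
    have "((\<lambda>y. \<bar>y - phi\<bar> * integral\<^sup>L lborel B) \<longlongrightarrow> \<bar>phi - phi\<bar> * integral\<^sup>L lborel B) (at phi)"
      by (intro tendsto_intros)
    thus "((\<lambda>y. \<bar>y - phi\<bar> * integral\<^sup>L lborel B) \<longlongrightarrow> 0) (at phi)" by simp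
  qed
qed

section \<open>Integrals of the rising factorials\<close>

definition mp_half_basis :: "nat \<Rightarrow> complex poly" where
  "mp_half_basis k = pochhammer [:1 / 2, \<i>:] k"

lemma poly_mp_half_basis: "poly (mp_half_basis k) x = pochhammer (1 / 2 + \<i> * x) k"
  by (induction k) (simp_all add: mp_half_basis_def pochhammer_Suc algebra_simps)

lemma one_minus_exp_neq_0:
  assumes "0 < phi" "phi < pi"
  shows "1 - exp (- 2 * \<i> * complex_of_real phi) \<noteq> 0"
proof
  assume "1 - exp (- 2 * \<i> * complex_of_real phi) = 0"
  hence "exp (\<i> * complex_of_real (- 2 * phi)) = 1" by (simp add: mult_ac)
  hence "cis (- 2 * phi) = 1" by (simp only: cis_conv_exp)
  hence "cos (- 2 * phi) = 1" by (simp add: complex_eq_iff)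
  moreover have "cos (2 * phi) = 1 - 2 * (sin phi)\<^sup>2" by (rule cos_double_sin)
  ultimately have "sin phi = 0" by simp
  with sin_gt_zero[OF assms] show False by simp
qed

text \<open>Euler's formula multiplied by e^(-i phi), so that only e^(-2 i phi) remains on the
  right.\<close>

lemma two_sin_times_exp:
  "2 * complex_of_real (sin phi) * exp (- (\<i> * complex_of_real phi)) =
   - \<i> * (1 - exp (- 2 * \<i> * complex_of_real phi))"
proof -
  have "exp (- 2 * \<i> * complex_of_real phi) = exp (- (\<i> * complex_of_real phi)) * exp (- (\<i> * complex_of_real phi))"
    by (simp add: mult.assoc flip: exp_add)
  thus ?thesis
    by (simp add: sin_of_real[symmetric] sin_exp_eq field_simps exp_minus)
qed

lemma two_cos_times_exp:
  "2 * complex_of_real (cos phi) * exp (- (\<i> * complex_of_real phi)) =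
   1 + exp (- 2 * \<i> * complex_of_real phi)"
proof -
  have "exp (- 2 * \<i> * complex_of_real phi) = exp (- (\<i> * complex_of_real phi)) * exp (- (\<i> * complex_of_real phi))"
    by (simp add: mult.assoc flip: exp_add)
  thus ?thesis
    by (simp add: cos_of_real[symmetric] cos_exp_eq algebra_simps flip: exp_add)
qed

text \<open>The next rising factorial has the extra factor 1/2 + k + i x, and i x is i/2 times the
  factor 2 x produced by differentiation in \<open>phi\<close>. Exponentials make the right-hand
  side easy to differentiate.\<close>

lemma mp_functional_half_basis_exp:
  assumes "0 < phi" "phi < pi"
  shows "mp_functional phi (mp_half_basis k) = 2 * pi * \<i> * fact k *
    exp (- (\<i> * of_real phi)) / (1 - exp (- 2 * \<i> * of_real phi)) ^ Suc k"
  using assms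
proof (induction k arbitrary: phi)
  case 0
  have "mp_functional phi (mp_half_basis 0) = of_real (LINT x|lborel. mp_weight phi x)"
    by (simp add: mp_functional_def mp_half_basis_def)
  also have "\<dots> = of_real pi / of_real (sin phi)"
    by (simp add: mp_weight_integral[OF 0])
  also have "\<dots> = 2 * of_real pi * \<i> * exp (- (\<i> * of_real phi)) /
      (\<i> * (2 * of_real (sin phi) * exp (- (\<i> * of_real phi))))"
    by simp
  also have "\<dots> = 2 * of_real pi * \<i> * exp (- (\<i> * of_real phi)) /
      (1 - exp (- 2 * \<i> * of_real phi))"
    unfolding two_sin_times_exp by simp
  finally show ?case by simp
next
  case (Suc k)
  \<comment> \<open>The claimed value as a function of a complex variable, so that the complex
    derivative rules apply before restricting to real angles.\<close>
  define G where "G = (\<lambda>z. 2 * pi * \<i> * fact k * exp (- (\<i> * z)) / (1 - exp (- 2 * \<i> * z)) ^ Suc k)"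
  define E where "E = exp (- 2 * \<i> * complex_of_real phi)"
  have E: "1 - E \<noteq> 0" unfolding E_def by (rule one_minus_exp_neq_0[OF Suc.prems])
  \<comment> \<open>With D = 1 - E, d = D^k and N = k + 1 this rewrites the quotient rule as G times
    its logarithmic derivative.\<close>
  have quotient: "c * (((- \<i> * u) * (D * d) - u * (N * d * (2 * \<i> * E))) / ((D * d) * (D * d))) =
      - \<i> * (c * u / (D * d)) * (1 + 2 * N * E / D)" if "D \<noteq> 0" "d \<noteq> 0" for c u D d N :: complex
    using that by (simp add: field_simps)
  have "(G has_field_derivative 2 * pi * \<i> * fact k *
      (((- \<i> * exp (- (\<i> * of_real phi))) * ((1 - E) * (1 - E) ^ k) -
        exp (- (\<i> * of_real phi)) * (of_nat (Suc k) * (1 - E) ^ k * (2 * \<i> * E))) /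
       (((1 - E) * (1 - E) ^ k) * ((1 - E) * (1 - E) ^ k)))) (at (of_real phi))"
    unfolding G_def times_divide_eq_right[symmetric] using E unfolding E_def
    by (intro DERIV_cmult DERIV_divide)
       (auto intro!: derivative_eq_intros simp del: of_nat_Suc, cases k, simp_all add: algebra_simps)
  hence "(G has_field_derivative - \<i> * G phi * (1 + 2 * of_nat (Suc k) * E / (1 - E))) (at (of_real phi))"
    unfolding G_def E_def[symmetric] power_Suc using E by (subst quotient[symmetric]) simp_all
  hence "((\<lambda>t. G (of_real t)) has_vector_derivative
      - \<i> * G phi * (1 + 2 * of_nat (Suc k) * E / (1 - E))) (at phi)"
    by (rule has_vector_derivative_real_field)
  \<comment> \<open>The induction hypothesis holds on all of (0, pi), an open set, so the two
    functions share their derivative at \<open>phi\<close>.\<close>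
  hence "((\<lambda>t. mp_functional t (mp_half_basis k)) has_vector_derivative
      - \<i> * G phi * (1 + 2 * of_nat (Suc k) * E / (1 - E))) (at phi)"
    by (rule has_vector_derivative_transform_within_open[where S = "{0<..<pi}"])
      (use Suc in \<open>auto simp: G_def\<close>)
  hence der: "mp_functional phi ([:0, 2:] * mp_half_basis k) =
      - \<i> * G phi * (1 + 2 * of_nat (Suc k) * E / (1 - E))"
    using mp_functional_has_vector_derivative[OF Suc.prems] vector_derivative_unique_at by blast
  have val: "mp_functional phi (mp_half_basis k) = G phi"
    using Suc.IH[OF Suc.prems] by (simp add: G_def)
  have "mp_half_basis (Suc k) = smult (1 / 2 + of_nat k) (mp_half_basis k) +
      smult (\<i> / 2) ([:0, 2:] * mp_half_basis k)"
    by (simp add: mp_half_basis_def pochhammer_Suc of_nat_poly algebra_simps)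
  hence "mp_functional phi (mp_half_basis (Suc k)) =
      (1 / 2 + of_nat k) * G phi + \<i> / 2 * (- \<i> * G phi * (1 + 2 * of_nat (Suc k) * E / (1 - E)))"
    by (simp only: mp_functional_add[OF Suc.prems] mp_functional_smult der val)
  \<comment> \<open>The constants add up to (k + 1) (1 + E / (1 - E)) = (k + 1) / (1 - E).\<close>
  also have "\<dots> = of_nat (Suc k) * G phi / (1 - E)"
    using E by (simp add: field_simps)
  finally show ?case by (simp add: G_def E_def mult_ac)
qed

text \<open>Comparison with the case k = 0, the total mass, identifies the exponential prefactor as
  pi / sin(phi).\<close>

lemma mp_functional_half_basis:
  assumes "0 < phi" "phi < pi"
  shows "mp_functional phi (mp_half_basis k) =
    of_real (pi / sin phi) * fact k / (1 - exp (- 2 * \<i> * of_real phi)) ^ k"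
  using mp_functional_half_basis_exp[OF assms, of k] mp_functional_half_basis_exp[OF assms, of 0]
    mp_weight_integral[OF assms]
  by (simp add: mp_functional_def mp_half_basis_def)

section \<open>The polynomials P_n^(1/2) and their integrals\<close>

text \<open>This is P_n^(1/2), with -(1 - e^(-2 i phi)) absorbing the sign of (-n)_k / k!.\<close>

definition mp_half :: "real \<Rightarrow> nat \<Rightarrow> complex poly" where
  "mp_half phi n = smult (exp (\<i> * of_nat n * of_real phi))
     (\<Sum>k\<le>n. smult (of_nat (n choose k) * (exp (- 2 * \<i> * of_real phi) - 1) ^ k / fact k)
        (mp_half_basis k))"

text \<open>The integral of each basis element cancels its coefficient up to the sign (-1)^k and the
  binomial coefficient, leaving (1 - 1)^n.\<close>

lemma mp_functional_mp_half:
  assumes "0 < phi" "phi < pi"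
  shows "mp_functional phi (mp_half phi n) = (if n = 0 then of_real (pi / sin phi) else 0)"
proof -
  let ?E = "exp (- 2 * \<i> * complex_of_real phi)"
  have E: "1 - ?E \<noteq> 0" by (rule one_minus_exp_neq_0[OF assms])
  have pow: "(?E - 1) ^ k / (1 - ?E) ^ k = (-1) ^ k" for k
  proof -
    have "(?E - 1) ^ k / (1 - ?E) ^ k = ((?E - 1) / (1 - ?E)) ^ k" by (simp add: power_divide)
    also have "(?E - 1) / (1 - ?E) = -1" using E by (simp add: divide_eq_minus_1_iff)
    finally show ?thesis .
  qed
  have *: "of_nat (n choose k) * (?E - 1) ^ k / fact k *
      (of_real (pi / sin phi) * fact k / (1 - ?E) ^ k) =
      of_real (pi / sin phi) * (of_nat (n choose k) * (-1) ^ k)" for k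
  proof -
    have "of_nat (n choose k) * (?E - 1) ^ k / fact k *
      (of_real (pi / sin phi) * fact k / (1 - ?E) ^ k) =
      of_real (pi / sin phi) * (of_nat (n choose k) * ((?E - 1) ^ k / (1 - ?E) ^ k))" by simp
    thus ?thesis by (simp only: pow)
  qed
  have "mp_functional phi (mp_half phi n) = exp (\<i> * of_nat n * of_real phi) *
      (\<Sum>k\<le>n. of_real (pi / sin phi) * (of_nat (n choose k) * (-1) ^ k))"
    unfolding mp_half_def mp_functional_smult mp_functional_sum[OF assms finite_atMost]
      mp_functional_half_basis[OF assms] * ..
  also have "(\<Sum>k\<le>n. of_real (pi / sin phi) * (of_nat (n choose k) * (-1) ^ k)) =
      complex_of_real (pi / sin phi) * (1 + -1) ^ n"
    unfolding sum_distrib_left[symmetric] by (subst add.commute, subst binomial_ring) (simp add: mult_ac)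
  finally show ?thesis by simp
qed

section \<open>The three-term recurrence\<close>

text \<open>\<open>S n\<close> is the hypergeometric sum 2F1(-n, z; 1; -y). Treating
  \<open>y\<close> and \<open>z\<close> as free leaves only binomial identities between
  coefficients. At n = 0 the factor n removes the term with the truncated index
  \<open>n - 1\<close>.\<close>

lemma pochhammer_sum_recurrence:
  fixes y z :: "'a :: field_char_0"
  defines "S \<equiv> (\<lambda>n. \<Sum>k\<le>n. of_nat (n choose k) * y ^ k / fact k * pochhammer z k)"
  shows "of_nat (n + 1) * S (n + 1) =
    (of_nat (2 * n + 1) + y * (z + of_nat n)) * S n - of_nat n * (1 + y) * S (n - 1)"
proof -
  define a where "a k = pochhammer z k / fact k" for k
  \<comment> \<open>A common upper limit for all three sums; the added binomial coefficients
    vanish.\<close>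
  define N where "N = n + 1"
  have S: "S m = (\<Sum>k\<le>N. of_nat (m choose k) * y ^ k * a k)" if "m \<le> N" for m
    unfolding S_def a_def using that
    by (intro sum.mono_neutral_cong_left) (auto simp: not_le binomial_eq_0)
  have Sn: "S n = (\<Sum>k\<le>N. of_nat (n choose k) * y ^ k * a k)"
    "S (n - 1) = (\<Sum>k\<le>N. of_nat (n - 1 choose k) * y ^ k * a k)"
    "S (n + 1) = (\<Sum>k\<le>N. of_nat (n + 1 choose k) * y ^ k * a k)"
    by (intro S; simp add: N_def)+
  \<comment> \<open>Multiplication by z + n raises the index k; the remaining term with n - k will
    cancel against \<open>S (n - 1)\<close> by \<open>comp\<close>.\<close>
  have za: "(z + of_nat n) * a k = of_nat (Suc k) * a (Suc k) + (of_nat n - of_nat k) * a k" for k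
    by (simp add: a_def pochhammer_Suc divide_simps del: of_nat_Suc) (simp add: algebra_simps)
  have comp: "of_nat n * of_nat (n - 1 choose k) =
      (of_nat n - of_nat k) * (of_nat (n choose k) :: 'a)" for k
  proof (cases "k \<le> n")
    case True
    show ?thesis
      unfolding of_nat_diff[OF True, symmetric] of_nat_mult[symmetric] binomial_absorb_comp
      by (rule refl)
  qed (simp add: binomial_eq_0)
  have coeff: "of_nat (n + 1) * of_nat (n + 1 choose k) = of_nat (2 * n + 1) * of_nat (n choose k) -
      of_nat n * of_nat (n - 1 choose k) + of_nat k * (of_nat (n choose (k - 1)) :: 'a)" for k
  proof (cases k)
    case (Suc j)
    have "of_nat (Suc j) * of_nat (n choose Suc j) =
        (of_nat n - of_nat j) * (of_nat (n choose j) :: 'a)"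
      unfolding comp[symmetric] of_nat_mult[symmetric] by (simp only: binomial_absorption)
    thus ?thesis unfolding comp Suc by (simp add: algebra_simps)
  qed (simp add: algebra_simps)
  have "y * (z + of_nat n) * S n - y * of_nat n * S (n - 1) =
      (\<Sum>k\<le>N. y ^ Suc k * (of_nat (n choose k) * ((z + of_nat n) * a k) -
         of_nat n * of_nat (n - 1 choose k) * a k))"
    unfolding Sn sum_distrib_left sum_subtractf[symmetric]
    by (intro sum.cong) (simp_all add: algebra_simps)
  also have "\<dots> = (\<Sum>k\<le>N. y ^ Suc k * (of_nat (n choose k) * (of_nat (Suc k) * a (Suc k))))"
    unfolding za comp by (intro sum.cong) (simp_all add: algebra_simps)
  \<comment> \<open>The top term drops because n choose n + 1 is 0, which makes room for an index
    shift. The new term at k = 0 vanishes by its factor k.\<close>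
  also have "\<dots> = (\<Sum>k\<le>n. y ^ Suc k * (of_nat (n choose k) * (of_nat (Suc k) * a (Suc k))))"
    by (simp add: N_def)
  also have "\<dots> = (\<Sum>k\<le>N. of_nat k * of_nat (n choose (k - 1)) * y ^ k * a k)"
    unfolding N_def Suc_eq_plus1[symmetric] sum.atMost_Suc_shift by (simp add: mult_ac)
  finally have shift: "y * (z + of_nat n) * S n - y * of_nat n * S (n - 1) = \<dots>" .
  have "of_nat (n + 1) * S (n + 1) = (\<Sum>k\<le>N. (of_nat (n + 1) * of_nat (n + 1 choose k)) * y ^ k * a k)"
    by (simp only: Sn sum_distrib_left mult.assoc)
  also have "\<dots> = of_nat (2 * n + 1) * S n - of_nat n * S (n - 1) +
      (\<Sum>k\<le>N. of_nat k * of_nat (n choose (k - 1)) * y ^ k * a k)"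
    unfolding coeff Sn sum_distrib_left sum_subtractf[symmetric] sum.distrib[symmetric]
    by (intro sum.cong) (simp_all add: algebra_simps)
  finally show ?thesis
    unfolding shift[symmetric] by (simp add: algebra_simps)
qed

text \<open>With e = e^(i phi) and y = e^(-2 i phi) - 1, the value of \<open>mp_half phi n\<close>
  is e^n times the sum of \<open>pochhammer_sum_recurrence\<close> at z = 1/2 + i x; Euler's
  formulas convert the coefficients.\<close>

lemma mp_half_recurrence:
  "smult (of_nat (n + 1)) (mp_half phi (n + 1)) =
   [:0, 2 * of_real (sin phi):] * mp_half phi n +
   smult (of_nat (2 * n + 1) * of_real (cos phi)) (mp_half phi n) -
   smult (of_nat n) (mp_half phi (n - 1))" (is "?L = ?R")
proof -
  define e where "e = exp (\<i> * complex_of_real phi)"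
  define y where "y = exp (- 2 * \<i> * complex_of_real phi) - 1"
  have inv: "exp (- (\<i> * complex_of_real phi)) = 1 / e"
    by (simp add: e_def exp_minus inverse_eq_divide)
  have e: "e \<noteq> 0" by (simp add: e_def)
  have y: "(1 + y) * e * e = 1"
    by (simp add: y_def e_def flip: exp_add)
  have sin: "2 * complex_of_real (sin phi) = \<i> * y * e"
    using two_sin_times_exp[of phi] e unfolding inv by (simp add: y_def field_simps)
  have cos: "2 * complex_of_real (cos phi) = (2 + y) * e"
    using two_cos_times_exp[of phi] e unfolding inv by (simp add: y_def field_simps)
  have "poly ?L x = poly ?R x" for x
  proof -
    define z where "z = 1 / 2 + \<i> * x"
    define S where "S n = (\<Sum>k\<le>n. of_nat (n choose k) * y ^ k / fact k * pochhammer z k)" for n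
    have p: "poly (mp_half phi n) x = e ^ n * S n" for n
      unfolding mp_half_def S_def y_def z_def e_def
      by (simp add: poly_sum poly_mp_half_basis exp_of_nat_mult[symmetric] mult_ac)
    have coeff: "2 * x * of_real (sin phi) + of_nat (2 * n + 1) * of_real (cos phi) =
        e * (of_nat (2 * n + 1) + y * (z + of_nat n))"
    proof -
      have "2 * x * of_real (sin phi) + of_nat (2 * n + 1) * of_real (cos phi) =
          x * (2 * of_real (sin phi)) + of_nat (2 * n + 1) / 2 * (2 * of_real (cos phi))"
        by simp
      also have "\<dots> = e * (of_nat (2 * n + 1) + y * (z + of_nat n))"
        unfolding sin cos z_def by (simp add: field_simps)
      finally show ?thesis .
    qed
    \<comment> \<open>Since (1 + y) e^2 = 1, two powers of e are lost; at n = 0 both sides are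
      0.\<close>
    have shift: "of_nat n * (1 + y) * e ^ (n + 1) = of_nat n * e ^ (n - 1)"
      using y by (cases n) (simp_all add: mult_ac)
    have "poly ?L x = e ^ (n + 1) * (of_nat (n + 1) * S (n + 1))"
      by (simp only: poly_smult p mult_ac)
    also have "\<dots> = e ^ n * (e * (of_nat (2 * n + 1) + y * (z + of_nat n))) * S n -
        of_nat n * (1 + y) * e ^ (n + 1) * S (n - 1)"
      unfolding S_def pochhammer_sum_recurrence by (simp add: algebra_simps)
    also have "\<dots> = poly ?R x"
      unfolding coeff[symmetric] shift by (simp add: p algebra_simps)
    finally show ?thesis .
  qed
  thus ?thesis by (intro poly_eq_poly_eq_iff[THEN iffD1] ext)
qed

section \<open>Orthogonality from the recurrence\<close>

lemma mp_half_0: "mp_half phi 0 = 1"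
  by (simp add: mp_half_def mp_half_basis_def)

text \<open>Induction on the second index, starting from the integrals of single polynomials.
  Applying the recurrence in either index gives the same term \<open>X\<close>; eliminating it
  expresses \<open>a n (j + 1)\<close> by entries with smaller second index.\<close>

lemma mp_functional_orthogonal:
  assumes "0 < phi" "phi < pi"
  shows "mp_functional phi (mp_half phi n * mp_half phi m) =
    (if n = m then of_real (pi / sin phi) else 0)"
proof -
  define a where "a n m = mp_functional phi (mp_half phi n * mp_half phi m)" for n m
  define c where "c = complex_of_real (cos phi)"
  define h where "h = complex_of_real (pi / sin phi)"
  define X where "X n m = mp_functional phi ([:0, 2 * of_real (sin phi):] * (mp_half phi n * mp_half phi m))"
    for n m
  have sym: "a n m = a m n" "X n m = X m n" for n m
    by (simp_all add: a_def X_def mult.commute)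
  have rec: "of_nat (n + 1) * a (n + 1) m =
      X n m + of_nat (2 * n + 1) * c * a n m - of_nat n * a (n - 1) m" for n m
  proof -
    have "smult (of_nat (n + 1)) (mp_half phi (n + 1) * mp_half phi m) =
        smult (of_nat (n + 1)) (mp_half phi (n + 1)) * mp_half phi m" by simp
    also have "\<dots> = [:0, 2 * of_real (sin phi):] * (mp_half phi n * mp_half phi m) +
        smult (of_nat (2 * n + 1) * c) (mp_half phi n * mp_half phi m) -
        smult (of_nat n) (mp_half phi (n - 1) * mp_half phi m)"
      unfolding mp_half_recurrence c_def
      by (simp only: left_diff_distrib distrib_right mult_smult_left mult.assoc)
    finally show ?thesis
      unfolding a_def X_def
      by (metis mp_functional_smult mp_functional_add[OF assms] mp_functional_diff[OF assms])
  qed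
  have a0: "a n 0 = (if n = 0 then h else 0)" for n
    by (simp add: a_def h_def mp_half_0 mp_functional_mp_half[OF assms])
  have "a n m = (if n = m then h else 0)"
  proof (induction m arbitrary: n rule: less_induct)
    case (less m)
    show ?case
    proof (cases m)
      case 0
      thus ?thesis by (simp add: a0)
    next
      case (Suc j)
      have IH: "a n j = (if n = j then h else 0)" for n
        using less.IH[of j] Suc by simp
      \<comment> \<open>The factor j also covers j = 0, where \<open>j - 1\<close> is
        truncated.\<close>
      have IH': "of_nat j * a n (j - 1) = (if n + 1 = j then of_nat j * h else 0)" for n
        using less.IH[of "j - 1"] Suc by (cases j) auto
      have "of_nat (j + 1) * a n (j + 1) = X n j + of_nat (2 * j + 1) * c * a n j - of_nat j * a n (j - 1)"
        using rec[of j n] by (simp only: sym[of j n] sym[of "j + 1" n] sym[of "j - 1" n])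
      also have "X n j = of_nat (n + 1) * a (n + 1) j - of_nat (2 * n + 1) * c * a n j + of_nat n * a (n - 1) j"
        using rec[of n j] by (simp add: algebra_simps)
      \<comment> \<open>The cosine terms survive only for n = j, where they cancel; the terms for n
        + 1 = j cancel as well. What remains is n h when n = j + 1.\<close>
      finally have "of_nat (j + 1) * a n (j + 1) = (if n = j + 1 then of_nat (j + 1) * h else 0)"
        unfolding IH IH' by (cases n) (auto split: if_splits)
      hence "a n (j + 1) = (if n = j + 1 then h else 0)"
        by (metis (full_types) mult_cancel_left mult_zero_right of_nat_eq_0_iff add_is_0 one_neq_zero)
      thus ?thesis by (simp add: Suc)
    qed
  qed
  thus ?thesis by (simp add: a_def h_def)
qed

section \<open>Hypergeometric sums, the difference operator and the inner product\<close>

lemma pochhammer_minus_of_nat: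
  "pochhammer (- of_nat n :: 'a :: field_char_0) k = (-1) ^ k * fact k * of_nat (n choose k)"
  by (simp add: binomial_gbinomial gbinomial_pochhammer mult.assoc[symmetric] power_mult_distrib[symmetric])

text \<open>The symbol (-n)_k vanishes for k > n, which ends the series; its sign is moved into the
  power of -z.\<close>

lemma hyp2F1_minus_of_nat:
  "hyp2F1 (- of_nat n) b c z =
   (\<Sum>k\<le>n. of_nat (n choose k) * pochhammer b k / pochhammer c k * (- z) ^ k)"
proof -
  have "hyp2F1 (- of_nat n) b c z =
      (\<Sum>k. pochhammer (- of_nat n) k * pochhammer b k / (pochhammer c k * fact k) * z ^ k)"
    by (simp add: hyp2F1_def eval_fps_def)
  also have "\<dots> = (\<Sum>k\<le>n. pochhammer (- of_nat n) k * pochhammer b k / (pochhammer c k * fact k) * z ^ k)"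
    by (rule suminf_finite) (auto simp: pochhammer_minus_of_nat not_le binomial_eq_0)
  also have "\<dots> = (\<Sum>k\<le>n. of_nat (n choose k) * pochhammer b k / pochhammer c k * (- z) ^ k)"
    unfolding pochhammer_minus_of_nat power_minus[of z] by (intro sum.cong) (simp_all add: mult_ac)
  finally show ?thesis .
qed

lemma pochhammer_2: "pochhammer (2 :: 'a :: field_char_0) k = fact (Suc k)"
  using pochhammer_rec[of "1 :: 'a" k] by (simp add: pochhammer_fact del: fact_Suc)

text \<open>The prefactor x completes (1 + i x)_k to (i x)_(k+1), up to the factor -i. In this form
  the difference operator acts termwise.\<close>

lemma meixner_pollaczek_0_Suc:
  "meixner_pollaczek_0 phi (Suc n) x = - 2 * \<i> * of_real (sin phi) * exp (\<i> * of_nat n * of_real phi) *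
    (\<Sum>k\<le>n. of_nat (n choose k) * (exp (- 2 * \<i> * of_real phi) - 1) ^ k / fact (Suc k) *
       pochhammer (\<i> * x) (Suc k))"
proof -
  let ?y = "exp (- 2 * \<i> * complex_of_real phi) - 1"
  have "meixner_pollaczek 1 phi n x = of_nat (Suc n) * exp (\<i> * of_nat n * of_real phi) *
      (\<Sum>k\<le>n. of_nat (n choose k) * ?y ^ k / fact (Suc k) * pochhammer (1 + \<i> * x) k)"
    unfolding meixner_pollaczek_def hyp2F1_minus_of_nat of_real_1 mult_1_right pochhammer_2 minus_diff_eq
    by (simp add: mult_ac)
  hence "meixner_pollaczek_0 phi (Suc n) x = 2 * of_real (sin phi) * exp (\<i> * of_nat n * of_real phi) *
      (\<Sum>k\<le>n. of_nat (n choose k) * ?y ^ k / fact (Suc k) * (x * pochhammer (1 + \<i> * x) k))"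
    by (simp add: meixner_pollaczek_0_def sum_distrib_left mult_ac del: fact_Suc of_nat_Suc)
  moreover have "x * pochhammer (1 + \<i> * x) k = - \<i> * pochhammer (\<i> * x) (Suc k)" for k
    unfolding pochhammer_rec by (simp add: add.commute mult.assoc)
  ultimately show ?thesis
    by (simp add: sum_distrib_left mult_ac del: fact_Suc)
qed

text \<open>With z = 1/2 + i x the two shifts yield (z - 1)_(k+1) and (z)_(k+1), which share the
  factor (z)_k. The cofactors z - 1 and z + k differ by k + 1, turning 1/(k+1)! into 1/k!.\<close>

lemma central_diff_meixner_pollaczek_0_Suc:
  "central_diff (meixner_pollaczek_0 phi (Suc n)) x = 2 * of_real (sin phi) * poly (mp_half phi n) x"
proof -
  have diff: "pochhammer (\<i> * (x + \<i> / 2)) (Suc k) - pochhammer (\<i> * (x - \<i> / 2)) (Suc k) =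
      - (fact (Suc k) / fact k) * pochhammer (1 / 2 + \<i> * x) k" for k
  proof -
    have args: "\<i> * (x - \<i> / 2) = 1 / 2 + \<i> * x" "\<i> * (x + \<i> / 2) = 1 / 2 + \<i> * x - 1"
      by (simp_all add: algebra_simps)
    show ?thesis
      unfolding args pochhammer_rec[of "1 / 2 + \<i> * x - 1"] pochhammer_rec'[of "1 / 2 + \<i> * x"]
      by (simp add: field_simps)
  qed
  show ?thesis
    unfolding central_diff_def meixner_pollaczek_0_Suc right_diff_distrib[symmetric]
      sum_subtractf[symmetric] diff mp_half_def
    by (simp add: poly_sum poly_mp_half_basis sum_distrib_left sum_negf mult_ac del: fact_Suc)
qed

lemma meixner_pollaczek_0_at_0: "meixner_pollaczek_0 phi n 0 = (if n = 0 then 1 else 0)"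
  by (simp add: meixner_pollaczek_0_def)

lemma central_diff_meixner_pollaczek_0_0: "central_diff (meixner_pollaczek_0 phi 0) x = 0"
  by (simp add: central_diff_def meixner_pollaczek_0_def)

(* The Bochner integral of a non-integrable function is 0, so convergence of the integral in
   the inner product is asserted explicitly. *)

theorem mainTheorem5:
  fixes phi :: real and n m :: nat
  assumes "0 < phi" and "phi < pi"
  shows "integrable lborel
           (mp0_integrand phi (meixner_pollaczek_0 phi n) (meixner_pollaczek_0 phi m)) \<and>
         mp0_inner phi (meixner_pollaczek_0 phi n) (meixner_pollaczek_0 phi m) =
           (if n = m then 1 else 0)"
proof (cases "n = 0 \<or> m = 0")
  case True
  \<comment> \<open>One of the two polynomials is constant, so its difference is 0 and only the
    product of values at 0 remains.\<close>
  hence "mp0_integrand phi (meixner_pollaczek_0 phi n) (meixner_pollaczek_0 phi m) = (\<lambda>x. 0)"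
    by (auto simp: mp0_integrand_def central_diff_meixner_pollaczek_0_0)
  thus ?thesis
    using True by (auto simp: mp0_inner_def meixner_pollaczek_0_at_0)
next
  case False
  then obtain j k where jk: "n = Suc j" "m = Suc k"
    by (auto simp: gr0_conv_Suc)
  \<comment> \<open>Each difference contributes 2 sin(phi). For j = k the resulting 4 sin(phi)^2
    times pi / sin(phi) cancels the normalization 1 / (4 pi sin(phi)).\<close>
  let ?p = "smult (4 * (of_real (sin phi))\<^sup>2) (mp_half phi j * mp_half phi k)"
  have weight: "exp ((2 * phi - pi) * x) * (norm (Gamma (1 / 2 + \<i> * complex_of_real x)))\<^sup>2 =
      mp_weight phi x" for x
    by (simp only: norm_Gamma_half_plus_imaginary mp_weight_def)
  have integrand: "mp0_integrand phi (meixner_pollaczek_0 phi n) (meixner_pollaczek_0 phi m) =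
      (\<lambda>x. poly ?p (of_real x) * of_real (mp_weight phi x))"
    unfolding mp0_integrand_def weight jk central_diff_meixner_pollaczek_0_Suc
    by (simp add: fun_eq_iff power2_eq_square)
  have "sin phi \<noteq> 0"
    using sin_gt_zero[OF assms] by simp
  hence "complex_of_real (1 / (4 * pi * sin phi)) * mp_functional phi ?p = (if j = k then 1 else 0)"
    unfolding mp_functional_smult mp_functional_orthogonal[OF assms]
    by (simp add: power2_eq_square)
  hence "mp0_inner phi (meixner_pollaczek_0 phi n) (meixner_pollaczek_0 phi m) = (if n = m then 1 else 0)"
    unfolding mp0_inner_def integrand mp_functional_def[symmetric] meixner_pollaczek_0_at_0
    by (simp add: jk)
  moreover have "integrable lborel
      (mp0_integrand phi (meixner_pollaczek_0 phi n) (meixner_pollaczek_0 phi m))"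
    unfolding integrand by (rule poly_mp_weight_integrable[OF assms])
  ultimately show ?thesis by blast
qed

end
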